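(* Let $\mathcal I$ be an ideal on a set $X$ and let $x\in X$. Let $\mathcal U_x=\{U\subseteq X\mid x\in U\}$, and let $j=\exp id_X\colon\exp(X_{\mathcal I})\to\exp(X_{\mathcal I\text{-}ary})$ be the identity map of $\mathcal P(X)$. Then: (i) the restriction $j\restriction_{\mathcal U_x}$ is an asymorphism between the subballeans with support $\mathcal U_x$ of $\exp(X_{\mathcal I})$ and of $\exp(X_{\mathcal I\text{-}ary})$; (ii) $\mathbb C(X,\mathcal I)$ and, in particular, $\exp^\ast(X_{\mathcal I\text{-}ary})$ are coarsely equivalent to the subballean of $\exp(X_{\mathcal I})$ with support $\mathcal U_x$, witnessed by the map $$j\restriction_{\mathcal U_x}\colon\exp(X_{\mathcal I})\restriction_{\mathcal U_x}\to\exp^\ast(X_{\mathcal I\text{-}ary})\subseteq\mathbb C(X,\mathcal I)$$ (i.e., this map is a coarse equivalence both as a map into $\mathbb C(X,\mathcal I)$ and as a map into $\exp^\ast(X_{\mathcal I\text{-}ary})$).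
   Context: A ballean is a triple $\mathcal B=(X,P,B)$ where $X$ (the support) and $P\neq\emptyset$ (the radii set) are sets and $B\colon X\times P\to\mathcal P(X)$ is a map such that: $x\in B(x,\alpha)$ for all $x,\alpha$; $x\in B(y,\alpha)$ iff $y\in B(x,\alpha)$; for all $\alpha,\beta\in P$ there is $\gamma\in P$ with $B(B(x,\alpha),\beta)\subseteq B(x,\gamma)$ for all $x\in X$, where $B(A,\delta)=\bigcup_{y\in A}B(y,\delta)$. The subballean $\mathcal B\restriction_Y$ on $Y\subseteq X$ is $(Y,P,B_Y)$ with $B_Y(y,\alpha)=B(y,\alpha)\cap Y$. A subset $A\subseteq X$ is large in $X$ if $B(A,\alpha)=X$ for some $\alpha\in P$. A map $f\colon X\to Y$ between balleans $(X,P_X,B_X)$, $(Y,P_Y,B_Y)$ is: coarse if for every $\alpha\in P_X$ there is $\beta\in P_Y$ with $f(B_X(x,\alpha))\subseteq B_Y(f(x),\beta)$ for all $x\in X$; effectively proper if for every $\alpha\in P_Y$ there is $\beta\in P_X$ with $f^{-1}(B_Y(f(x),\alpha))\subseteq B_X(x,\beta)$ for all $x\in X$; a coarse embedding if it is both coarse and effectively proper; an asymorphism if it is bijective and both $f$ and $f^{-1}$ are coarse; a coarse equivalence if it is a coarse embedding and $f(X)$ is large in $Y$. An ideal $\mathcal I$ on $X$ is a family of subsets of $X$ closed under finite unions and subsets; it is always assumed that $X\notin\mathcal I$ and that $\mathcal I$ contains all finite subsets of $X$. The $\mathcal I$-ary ballean $X_{\mathcal I\text{-}ary}=(X,\mathcal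 I,B_{\mathcal I\text{-}ary})$ has balls $B_{\mathcal I\text{-}ary}(x,A)=\{x\}\cup A$. The point ideal ballean $X_{\mathcal I}=(X,\mathcal I,B_{\mathcal I})$ has balls $B_{\mathcal I}(x,A)=\{x\}$ if $x\notin A$ and $B_{\mathcal I}(x,A)=A$ if $x\in A$. The hyperballean of $\mathcal B=(X,P,B)$ is $\exp(\mathcal B)=(\mathcal P(X),P,\exp B)$, with $\exp B(A,\alpha)=\{C\in\mathcal P(X)\mid A\subseteq B(C,\alpha),\ C\subseteq B(A,\alpha)\}$; $\exp^\ast(\mathcal B)$ is its subballean on $\mathcal P(X)\setminus\{\emptyset\}$. The ballean $\mathbb C(X,\mathcal I)$ has support $\mathcal P(X)$ (identified with $\{0,1\}^X$ via characteristic functions), radii set $\mathcal I$ and balls $B_{\mathbb C}(A,K)=\{Y\subseteq X\mid A\setminus K\subseteq Y\subseteq A\cup K\}$. Its subballean on $\mathcal P(X)\setminus\{\emptyset\}$ coincides with $\exp^\ast(X_{\mathcal I\text{-}ary})$. *)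

theory Defs
  imports Main "HOL-Library.FuncSet"
begin

text \<open>
  The record carries only the data of a ballean; the axioms are the predicate \<open>ballean\<close>
  below. Values of \<open>ball\<close> outside \<open>support \<times> radii\<close> are irrelevant.
\<close>

record ('a, 'p) ball_structure =
  support :: "'a set"
  radii :: "'p set"
  ball :: "'a \<Rightarrow> 'p \<Rightarrow> 'a set"

definition ball_set :: "('a, 'p) ball_structure \<Rightarrow> 'a set \<Rightarrow> 'p \<Rightarrow> 'a set" where
  "ball_set B A \<delta> = (\<Union>y\<in>A. ball B y \<delta>)"

definition ballean :: "('a, 'p) ball_structure \<Rightarrow> bool" where
  "ballean B \<longleftrightarrow>
     radii B \<noteq> {} \<and>
     (\<forall>x\<in>support B. \<forall>\<alpha>\<in>radii B. ball B x \<alpha> \<subseteq> support B) \<and>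
     (\<forall>x\<in>support B. \<forall>\<alpha>\<in>radii B. x \<in> ball B x \<alpha>) \<and>
     (\<forall>x\<in>support B. \<forall>y\<in>support B. \<forall>\<alpha>\<in>radii B. x \<in> ball B y \<alpha> \<longleftrightarrow> y \<in> ball B x \<alpha>) \<and>
     (\<forall>\<alpha>\<in>radii B. \<forall>\<beta>\<in>radii B. \<exists>\<gamma>\<in>radii B. \<forall>x\<in>support B.
        ball_set B (ball B x \<alpha>) \<beta> \<subseteq> ball B x \<gamma>)"

definition subballean :: "('a, 'p) ball_structure \<Rightarrow> 'a set \<Rightarrow> ('a, 'p) ball_structure" where
  "subballean B Y = \<lparr>support = Y, radii = radii B, ball = (\<lambda>y \<alpha>. ball B y \<alpha> \<inter> Y)\<rparr>"

definition large :: "('a, 'p) ball_structure \<Rightarrow> 'a set \<Rightarrow> bool" where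
  "large B A \<longleftrightarrow> A \<subseteq> support B \<and> (\<exists>\<alpha>\<in>radii B. ball_set B A \<alpha> = support B)"

definition map_between_balleans ::
    "('a, 'p) ball_structure \<Rightarrow> ('b, 'q) ball_structure \<Rightarrow> ('a \<Rightarrow> 'b) \<Rightarrow> bool" where
  "map_between_balleans B C f \<longleftrightarrow> ballean B \<and> ballean C \<and> f \<in> support B \<rightarrow> support C"

definition coarse_map ::
    "('a, 'p) ball_structure \<Rightarrow> ('b, 'q) ball_structure \<Rightarrow> ('a \<Rightarrow> 'b) \<Rightarrow> bool" where
  "coarse_map B C f \<longleftrightarrow> map_between_balleans B C f \<and>
     (\<forall>\<alpha>\<in>radii B. \<exists>\<beta>\<in>radii C. \<forall>x\<in>support B. f ` ball B x \<alpha> \<subseteq> ball C (f x) \<beta>)"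

definition effectively_proper ::
    "('a, 'p) ball_structure \<Rightarrow> ('b, 'q) ball_structure \<Rightarrow> ('a \<Rightarrow> 'b) \<Rightarrow> bool" where
  "effectively_proper B C f \<longleftrightarrow> map_between_balleans B C f \<and>
     (\<forall>\<alpha>\<in>radii C. \<exists>\<beta>\<in>radii B. \<forall>x\<in>support B.
        f -` ball C (f x) \<alpha> \<inter> support B \<subseteq> ball B x \<beta>)"

definition coarse_embedding ::
    "('a, 'p) ball_structure \<Rightarrow> ('b, 'q) ball_structure \<Rightarrow> ('a \<Rightarrow> 'b) \<Rightarrow> bool" where
  "coarse_embedding B C f \<longleftrightarrow> coarse_map B C f \<and> effectively_proper B C f"

definition asymorphism ::
    "('a, 'p) ball_structure \<Rightarrow> ('b, 'q) ball_structure \<Rightarrow> ('a \<Rightarrow> 'b) \<Rightarrow> bool" where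
  "asymorphism B C f \<longleftrightarrow> bij_betw f (support B) (support C) \<and>
     coarse_map B C f \<and> coarse_map C B (inv_into (support B) f)"

definition coarse_equivalence ::
    "('a, 'p) ball_structure \<Rightarrow> ('b, 'q) ball_structure \<Rightarrow> ('a \<Rightarrow> 'b) \<Rightarrow> bool" where
  "coarse_equivalence B C f \<longleftrightarrow> coarse_embedding B C f \<and> large C (f ` support B)"

definition ideal_on :: "'a set \<Rightarrow> 'a set set \<Rightarrow> bool" where
  "ideal_on X \<I> \<longleftrightarrow>
     \<I> \<subseteq> Pow X \<and>
     (\<forall>A\<in>\<I>. \<forall>B\<in>\<I>. A \<union> B \<in> \<I>) \<and>
     (\<forall>A\<in>\<I>. \<forall>B. B \<subseteq> A \<longrightarrow> B \<in> \<I>) \<and>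
     X \<notin> \<I> \<and>
     (\<forall>F. F \<subseteq> X \<and> finite F \<longrightarrow> F \<in> \<I>)"

text \<open>
  The balls \<open>{x} \<union> A\<close> do not satisfy the symmetry axiom (take \<open>x \<in> A\<close> and \<open>y \<notin> A\<close>), so
  \<open>iary_ballean X \<I>\<close>, although called a ballean, is not a \<open>ballean\<close> for any ideal \<open>\<I>\<close> on \<open>X\<close>.
  Only its hyperballean is used, whose balls are symmetric by their very definition.
\<close>

definition iary_ballean :: "'a set \<Rightarrow> 'a set set \<Rightarrow> ('a, 'a set) ball_structure" where
  "iary_ballean X \<I> = \<lparr>support = X, radii = \<I>, ball = (\<lambda>x A. {x} \<union> A)\<rparr>"

definition point_ideal_ballean :: "'a set \<Rightarrow> 'a set set \<Rightarrow> ('a, 'a set) ball_structure" where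
  "point_ideal_ballean X \<I> =
     \<lparr>support = X, radii = \<I>, ball = (\<lambda>x A. if x \<in> A then A else {x})\<rparr>"

definition hyperballean :: "('a, 'p) ball_structure \<Rightarrow> ('a set, 'p) ball_structure" where
  "hyperballean B = \<lparr>support = Pow (support B), radii = radii B,
     ball = (\<lambda>A \<alpha>. {C \<in> Pow (support B). A \<subseteq> ball_set B C \<alpha> \<and> C \<subseteq> ball_set B A \<alpha>})\<rparr>"

definition nonempty_hyperballean :: "('a, 'p) ball_structure \<Rightarrow> ('a set, 'p) ball_structure" where
  "nonempty_hyperballean B = subballean (hyperballean B) (Pow (support B) - {{}})"

definition exp_map :: "('a \<Rightarrow> 'b) \<Rightarrow> 'a set \<Rightarrow> 'b set" where
  "exp_map f A = f ` A"

definition cube_ballean :: "'a set \<Rightarrow> 'a set set \<Rightarrow> ('a set, 'a set) ball_structure" where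
  "cube_ballean X \<I> = \<lparr>support = Pow X, radii = \<I>,
     ball = (\<lambda>A K. {Y \<in> Pow X. A - K \<subseteq> Y \<and> Y \<subseteq> A \<union> K})\<rparr>"

definition sets_containing :: "'a set \<Rightarrow> 'a \<Rightarrow> 'a set set" where
  "sets_containing X x = {U. U \<subseteq> X \<and> x \<in> U}"

end

(*
  For nonempty C the ball around C of radius K is C \<union> K in X_I-ary, and in X_I it is C \<union> K once
  C meets K. Every member of U_x meets K \<union> {x}, so on U_x the radius K \<union> {x} of exp(X_I) gives
  the same ball as in the cube; this makes j effectively proper. Adding the point x moves any
  subset of X by at most {x}, so U_x is large.
*)

theory Submission
  imports Defs
begin

text \<open>Composing two restricted balls yields a subset of the composite of the full balls, still
  cut down to \<open>Y\<close>. Hence a radius \<gamma> that serves \<alpha> and \<beta> on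
  \<open>B\<close> also serves them on \<open>Y\<close>.\<close>

lemma ballean_subballean:
  assumes "ballean B" "Y \<subseteq> support B"
  shows "ballean (subballean B Y)"
proof -
  have trans: "\<forall>\<alpha>\<in>radii B. \<forall>\<beta>\<in>radii B. \<exists>\<gamma>\<in>radii B. \<forall>x\<in>support B.
      (\<Union>y\<in>ball B x \<alpha>. ball B y \<beta>) \<subseteq> ball B x \<gamma>"
    using assms(1) unfolding ballean_def ball_set_def by (elim conjE)
  have comp: "\<exists>\<gamma>\<in>radii B. \<forall>x\<in>Y. (\<Union>y\<in>ball B x \<alpha> \<inter> Y. ball B y \<beta> \<inter> Y) \<subseteq> ball B x \<gamma> \<inter> Y"
    if \<alpha>\<beta>: "\<alpha> \<in> radii B" "\<beta> \<in> radii B" for \<alpha> \<beta>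
  proof -
    obtain \<gamma> where \<gamma>: "\<gamma> \<in> radii B"
      "\<And>x. x \<in> support B \<Longrightarrow> (\<Union>y\<in>ball B x \<alpha>. ball B y \<beta>) \<subseteq> ball B x \<gamma>"
      using trans \<alpha>\<beta> by meson
    show ?thesis
    proof (intro bexI[of _ \<gamma>] ballI)
      fix x assume "x \<in> Y"
      with assms(2) have "x \<in> support B" by blast
      from \<gamma>(2)[OF this]
      show "(\<Union>y\<in>ball B x \<alpha> \<inter> Y. ball B y \<beta> \<inter> Y) \<subseteq> ball B x \<gamma> \<inter> Y" by blast
    qed (rule \<gamma>(1))
  qed
  have "radii B \<noteq> {}" "\<forall>x\<in>Y. \<forall>\<alpha>\<in>radii B. x \<in> ball B x \<alpha>"
    "\<forall>x\<in>Y. \<forall>y\<in>Y. \<forall>\<alpha>\<in>radii B. x \<in> ball B y \<alpha> \<longleftrightarrow> y \<in> ball B x \<alpha>"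
    using assms unfolding ballean_def by (meson subsetD)+
  with comp show ?thesis
    unfolding ballean_def subballean_def ball_set_def ball_structure.simps by (intro conjI) blast+
qed

lemma point_ideal_ballean_simps [simp]:
  "support (point_ideal_ballean X \<I>) = X"
  "radii (point_ideal_ballean X \<I>) = \<I>"
  by (simp_all add: point_ideal_ballean_def)

lemma iary_ballean_simps [simp]:
  "support (iary_ballean X \<I>) = X"
  "radii (iary_ballean X \<I>) = \<I>"
  by (simp_all add: iary_ballean_def)

text \<open>A point outside \<open>A\<close> contributes only itself, while a single point inside
  \<open>A\<close> contributes all of \<open>A\<close>. So \<open>A\<close> is added entirely or not
  at all.\<close>

lemma ball_set_point_ideal:
  "ball_set (point_ideal_ballean X \<I>) U A = (if U \<inter> A = {} then U else U \<union> A)"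
  by (auto simp: ball_set_def point_ideal_ballean_def split: if_splits)

text \<open>Any one point already contributes all of \<open>A\<close>. The empty set is the
  exception because the union over it is empty; this is where the hyperballean and the cube part
  ways.\<close>

lemma ball_set_iary:
  "ball_set (iary_ballean X \<I>) U A = (if U = {} then {} else U \<union> A)"
  by (auto simp: ball_set_def iary_ballean_def)

text \<open>A ball of radius \<open>K\<close> collects the sets that differ from its centre only
  inside \<open>K\<close>. This relation is symmetric, and differences inside \<alpha> and then
  \<beta> stay inside their union.\<close>

lemma ballean_cube:
  assumes "ideal_on X \<I>"
  shows "ballean (cube_ballean X \<I>)"
proof -
  have "{} \<in> \<I>" and un: "\<And>A B. A \<in> \<I> \<Longrightarrow> B \<in> \<I> \<Longrightarrow> A \<union> B \<in> \<I>"
    using assms unfolding ideal_on_def by auto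
  have "\<exists>\<gamma>\<in>\<I>. \<forall>A\<in>Pow X. ball_set (cube_ballean X \<I>) (ball (cube_ballean X \<I>) A \<alpha>) \<beta>
      \<subseteq> ball (cube_ballean X \<I>) A \<gamma>" if "\<alpha> \<in> \<I>" "\<beta> \<in> \<I>" for \<alpha> \<beta>
    using un[OF that]
    by (intro bexI[of _ "\<alpha> \<union> \<beta>"]) (auto simp: cube_ballean_def ball_set_def)
  with \<open>{} \<in> \<I>\<close> show ?thesis
    unfolding ballean_def by (auto simp: cube_ballean_def)
qed

lemma ballean_hyper_point_ideal:
  assumes "ideal_on X \<I>"
  shows "ballean (hyperballean (point_ideal_ballean X \<I>))" (is "ballean ?H")
proof -
  have "{} \<in> \<I>" and un: "\<And>A B. A \<in> \<I> \<Longrightarrow> B \<in> \<I> \<Longrightarrow> A \<union> B \<in> \<I>"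
    using assms unfolding ideal_on_def by auto
  have H: "support ?H = Pow X" "radii ?H = \<I>"
    by (simp_all add: hyperballean_def)
  \<comment> \<open>If one of the two sets misses \<open>K\<close>, it does not grow, so the other
    lies in it and misses \<open>K\<close> as well. Both inclusions then hold without enlargement
    and the sets coincide.\<close>
  have B: "C \<in> ball ?H A K \<longleftrightarrow> C \<subseteq> X \<and>
      (A = C \<or> A \<inter> K \<noteq> {} \<and> C \<inter> K \<noteq> {} \<and> A \<subseteq> C \<union> K \<and> C \<subseteq> A \<union> K)" for A C K
  proof (cases "A \<inter> K = {} \<or> C \<inter> K = {}")
    case True
    then show ?thesis by (auto simp: hyperballean_def ball_set_point_ideal)
  qed (auto simp: hyperballean_def ball_set_point_ideal)
  have "\<exists>\<gamma>\<in>\<I>. \<forall>A\<in>Pow X. ball_set ?H (ball ?H A \<alpha>) \<beta> \<subseteq> ball ?H A \<gamma>"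
    if "\<alpha> \<in> \<I>" "\<beta> \<in> \<I>" for \<alpha> \<beta>
  proof (intro bexI[of _ "\<alpha> \<union> \<beta>"] ballI subsetI)
    fix A D assume "D \<in> ball_set ?H (ball ?H A \<alpha>) \<beta>"
    then obtain C where "C \<in> ball ?H A \<alpha>" "D \<in> ball ?H C \<beta>"
      by (auto simp: ball_set_def)
    \<comment> \<open>If neither step is an equality, \<open>A\<close> meets \<alpha> and
      \<open>D\<close> meets \<beta>, so both meet the union and the second alternative of
      \<open>B\<close> applies.\<close>
    then show "D \<in> ball ?H A (\<alpha> \<union> \<beta>)"
      unfolding B by (elim conjE disjE) (simp; blast)+
  qed (rule un[OF that])
  with \<open>{} \<in> \<I>\<close> show ?thesis
    unfolding ballean_def H by (intro conjI ballI) (simp_all add: B subset_iff, blast+)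
qed

text \<open>The base structure is not symmetric, so its hyperballean is checked directly against the
  axioms. Symmetry comes from the two-sided definition of the hyperballs.\<close>

lemma ballean_hyper_iary:
  assumes "ideal_on X \<I>"
  shows "ballean (hyperballean (iary_ballean X \<I>))" (is "ballean ?H")
proof -
  have "{} \<in> \<I>" and un: "\<And>A B. A \<in> \<I> \<Longrightarrow> B \<in> \<I> \<Longrightarrow> A \<union> B \<in> \<I>"
    using assms unfolding ideal_on_def by auto
  have H: "support ?H = Pow X" "radii ?H = \<I>"
    by (simp_all add: hyperballean_def)
  \<comment> \<open>The empty set has only itself in its balls and lies in no ball around another
    set, which accounts for the separate case \<open>A = C\<close>.\<close>
  have B: "C \<in> ball ?H A K \<longleftrightarrow> C \<subseteq> X \<and>
      (A = C \<or> A \<noteq> {} \<and> C \<noteq> {} \<and> A \<subseteq> C \<union> K \<and> C \<subseteq> A \<union> K)" for A C K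
    by (cases "A = {}"; cases "C = {}") (auto simp: hyperballean_def ball_set_iary)
  have "\<exists>\<gamma>\<in>\<I>. \<forall>A\<in>Pow X. ball_set ?H (ball ?H A \<alpha>) \<beta> \<subseteq> ball ?H A \<gamma>"
    if "\<alpha> \<in> \<I>" "\<beta> \<in> \<I>" for \<alpha> \<beta>
  proof (intro bexI[of _ "\<alpha> \<union> \<beta>"] ballI subsetI)
    fix A D assume "D \<in> ball_set ?H (ball ?H A \<alpha>) \<beta>"
    then obtain C where "C \<in> ball ?H A \<alpha>" "D \<in> ball ?H C \<beta>"
      by (auto simp: ball_set_def)
    then show "D \<in> ball ?H A (\<alpha> \<union> \<beta>)"
      unfolding B by (elim conjE disjE) (simp; blast)+
  qed (rule un[OF that])
  with \<open>{} \<in> \<I>\<close> show ?thesis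
    unfolding ballean_def H by (intro conjI ballI) (simp_all add: B subset_iff, blast+)
qed

text \<open>For nonempty sets, the condition \<open>A \<subseteq> C \<union> K\<close> is
  \<open>A - K \<subseteq> C\<close>. The trace on \<Y> discards the empty set, which belongs to the
  cube ball whenever \<open>A \<subseteq> K\<close> but never to the hyperball.\<close>

lemma ball_hyper_iary:
  assumes "A \<noteq> {}" "\<Y> \<subseteq> Pow X - {{}}"
  shows "ball (hyperballean (iary_ballean X \<I>)) A K \<inter> \<Y> = ball (cube_ballean X \<I>) A K \<inter> \<Y>"
  using assms
  by (auto simp: hyperballean_def ball_set_iary cube_ballean_def split: if_splits)

lemma ballean_hyper_iary_sub:
  assumes "ideal_on X \<I>" "\<Y> \<subseteq> Pow X - {{}}"
  shows "ballean (subballean (hyperballean (iary_ballean X \<I>)) \<Y>)"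
  using assms by (intro ballean_subballean ballean_hyper_iary)
    (auto simp: hyperballean_def)

text \<open>The preimage of a ball under a bijection is its image under the inverse, so effective
  properness of \<open>f\<close> is coarseness of the inverse.\<close>

lemma coarse_map_inv_into:
  assumes "effectively_proper B C f" "bij_betw f (support B) (support C)"
  shows "coarse_map C B (inv_into (support B) f)"
proof -
  let ?g = "inv_into (support B) f"
  have m: "ballean B" "ballean C"
    and p: "\<forall>\<alpha>\<in>radii C. \<exists>\<beta>\<in>radii B. \<forall>x\<in>support B.
        f -` ball C (f x) \<alpha> \<inter> support B \<subseteq> ball B x \<beta>"
    using assms(1) unfolding effectively_proper_def map_between_balleans_def by simp_all
  have g: "?g y \<in> support B" "f (?g y) = y" if "y \<in> support C" for y
    using assms(2) that
    by (simp_all add: bij_betw_def inv_into_into f_inv_into_f)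
  have coarse: "\<exists>\<beta>\<in>radii B. \<forall>y\<in>support C. ?g ` ball C y \<alpha> \<subseteq> ball B (?g y) \<beta>"
    if a: "\<alpha> \<in> radii C" for \<alpha>
  proof -
    obtain \<beta> where b: "\<beta> \<in> radii B"
      "\<forall>x\<in>support B. f -` ball C (f x) \<alpha> \<inter> support B \<subseteq> ball B x \<beta>"
      using bspec[OF p a] by blast
    have "?g z \<in> ball B (?g y) \<beta>" if "y \<in> support C" "z \<in> ball C y \<alpha>" for y z
    proof -
      \<comment> \<open>Needed because \<open>f\<close> undoes \<open>?g\<close> only on the support
        of \<open>C\<close>.\<close>
      have "ball C y \<alpha> \<subseteq> support C"
        using m(2) a that(1) unfolding ballean_def by simp
      with that(2) have "z \<in> support C" ..
      with that g have "?g z \<in> f -` ball C (f (?g y)) \<alpha> \<inter> support B" by simp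
      with b(2) g(1)[OF that(1)] show ?thesis by blast
    qed
    with b(1) show ?thesis by blast
  qed
  have "map_between_balleans C B ?g"
    unfolding map_between_balleans_def using m g(1) by blast
  with coarse show ?thesis
    unfolding coarse_map_def by blast
qed

text \<open>Stated for an arbitrary target \<open>C\<close> so that it covers all three targets of
  the theorem. Since the map is the identity, only the traces on \<U> of the balls of
  \<open>C\<close> around members of \<U> enter, and these are prescribed to be those of the
  cube.\<close>

lemma coarse_embedding_sets_containing:
  fixes X :: "'a set" and \<I> :: "'a set set" and x :: 'a
    and C :: "('a set, 'a set) ball_structure"
  defines "\<U> \<equiv> sets_containing X x"
  assumes I: "ideal_on X \<I>" and x: "x \<in> X"
    and C: "ballean C" "\<U> \<subseteq> support C" "radii C = \<I>"
    and ball: "\<And>U K. U \<in> \<U> \<Longrightarrow> ball C U K \<inter> \<U> = ball (cube_ballean X \<I>) U K \<inter> \<U>"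
  shows "coarse_embedding (subballean (hyperballean (point_ideal_ballean X \<I>)) \<U>) C
           (restrict (exp_map id) \<U>)" (is "coarse_embedding ?P C ?j")
proof -
  have j: "?j U = U" if "U \<in> \<U>" for U
    using that by (simp add: exp_map_def)
  have UX: "\<U> \<subseteq> Pow X" and xU: "\<And>U. U \<in> \<U> \<Longrightarrow> x \<in> U"
    by (auto simp: \<U>_def sets_containing_def)
  have P: "support ?P = \<U>" "radii ?P = \<I>"
    by (simp_all add: subballean_def hyperballean_def)
  have ballP: "V \<in> ball ?P U K \<longleftrightarrow> V \<in> \<U> \<and> V \<in> Pow X \<and>
      U \<subseteq> (if V \<inter> K = {} then V else V \<union> K) \<and> V \<subseteq> (if U \<inter> K = {} then U else U \<union> K)"
    for U V K
    by (auto simp: subballean_def hyperballean_def ball_set_point_ideal)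
  have ballC: "V \<in> ball C U K \<longleftrightarrow> V \<in> Pow X \<and> U - K \<subseteq> V \<and> V \<subseteq> U \<union> K"
    if "U \<in> \<U>" "V \<in> \<U>" for U V K
    using ball[OF that(1), of K] that(2) by (auto simp: cube_ballean_def)
  have "ballean ?P"
    using UX by (intro ballean_subballean ballean_hyper_point_ideal I)
      (simp add: hyperballean_def)
  then have m: "map_between_balleans ?P C ?j"
    unfolding map_between_balleans_def P using C j by auto
  \<comment> \<open>The radius stays the same: whether or not a set meets \<open>K\<close>, its
    enlargement lies within its union with \<open>K\<close>.\<close>
  have c: "?j ` ball ?P U K \<subseteq> ball C (?j U) K" if U: "U \<in> \<U>" for U K
  proof
    fix W assume "W \<in> ?j ` ball ?P U K"
    then obtain V where V: "V \<in> ball ?P U K" "W = ?j V" by blast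
    then have "V \<in> \<U>" by (simp add: ballP)
    with V(1) U have "V \<in> ball C U K"
      by (auto simp: ballP ballC split: if_splits)
    then show "W \<in> ball C (?j U) K"
      unfolding V(2) j[OF U] j[OF \<open>V \<in> \<U>\<close>] .
  qed
  have e: "?j -` ball C (?j U) K \<inter> \<U> \<subseteq> ball ?P U (K \<union> {x})" if U: "U \<in> \<U>" for U K
  proof
    fix V assume V: "V \<in> ?j -` ball C (?j U) K \<inter> \<U>"
    then have "V \<in> ball C U K" "V \<in> \<U>" using j U by auto
    with U xU[OF U] xU[of V] show "V \<in> ball ?P U (K \<union> {x})"
      by (auto simp: ballP ballC)
  qed
  have "K \<union> {x} \<in> \<I>" if "K \<in> \<I>" for K
  proof -
    have "{x} \<in> \<I>" using I x unfolding ideal_on_def by blast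
    with I that show ?thesis unfolding ideal_on_def by blast
  qed
  then have
    "\<forall>K\<in>\<I>. \<exists>L\<in>radii C. \<forall>U\<in>\<U>. ?j ` ball ?P U K \<subseteq> ball C (?j U) L"
    "\<forall>K\<in>radii C. \<exists>L\<in>\<I>. \<forall>U\<in>\<U>. ?j -` ball C (?j U) K \<inter> \<U> \<subseteq> ball ?P U L"
    using c e C(3) by (metis, metis)
  with m show ?thesis
    unfolding coarse_embedding_def coarse_map_def effectively_proper_def P by (intro conjI)
qed

theorem theorem3p3:
  fixes X :: "'a set" and \<I> :: "'a set set" and x :: 'a
  assumes "ideal_on X \<I>" and "x \<in> X"
  shows "let \<U> = sets_containing X x;
             j = restrict (exp_map (id :: 'a \<Rightarrow> 'a)) \<U>
         in asymorphism (subballean (hyperballean (point_ideal_ballean X \<I>)) \<U>)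
                        (subballean (hyperballean (iary_ballean X \<I>)) \<U>) j \<and>
            coarse_equivalence (subballean (hyperballean (point_ideal_ballean X \<I>)) \<U>)
                               (cube_ballean X \<I>) j \<and>
            coarse_equivalence (subballean (hyperballean (point_ideal_ballean X \<I>)) \<U>)
                               (nonempty_hyperballean (iary_ballean X \<I>)) j"
proof -
  define \<U> where "\<U> = sets_containing X x"
  define j where "j = restrict (exp_map (id :: 'a \<Rightarrow> 'a)) \<U>"
  let ?P = "subballean (hyperballean (point_ideal_ballean X \<I>)) \<U>"
  let ?H = "hyperballean (iary_ballean X \<I>)"
  let ?E = "nonempty_hyperballean (iary_ballean X \<I>)"
  have UX: "\<U> \<subseteq> Pow X - {{}}" and ne: "\<And>U. U \<in> \<U> \<Longrightarrow> U \<noteq> {}"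
    by (auto simp: \<U>_def sets_containing_def)
  have xI: "{x} \<in> \<I>" using assms unfolding ideal_on_def by blast
  have sP: "support ?P = \<U>" and sE: "support ?E = Pow X - {{}}"
    by (simp_all add: subballean_def nonempty_hyperballean_def)
  have im: "j ` \<U> = \<U>"
    by (simp add: j_def exp_map_def)
  \<comment> \<open>This reduces each embedding claim to comparing the target balls with cube balls
    on \<U>.\<close>
  note emb = coarse_embedding_sets_containing[OF assms, folded \<U>_def, folded j_def]
  have bE: "ball ?E A K = ball (cube_ballean X \<I>) A K \<inter> (Pow X - {{}})" if "A \<noteq> {}" for A K
    using ball_hyper_iary[OF that, of "Pow X - {{}}" X \<I> K]
    by (simp add: nonempty_hyperballean_def subballean_def)
  have near: "insert x Y \<in> \<U>" "Y \<in> ball (cube_ballean X \<I>) (insert x Y) {x}" if "Y \<subseteq> X" for Y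
    using that assms(2) by (auto simp: \<U>_def sets_containing_def cube_ballean_def)

  have "ball (subballean ?H \<U>) U K \<inter> \<U> = ball (cube_ballean X \<I>) U K \<inter> \<U>"
    if "U \<in> \<U>" for U K
    using ball_hyper_iary[OF ne[OF that] UX] by (simp add: subballean_def)
  then have "coarse_embedding ?P (subballean ?H \<U>) j"
    by (intro emb ballean_hyper_iary_sub assms(1) UX)
       (simp_all add: subballean_def hyperballean_def)
  moreover have "bij_betw j (support ?P) (support (subballean ?H \<U>))"
    unfolding sP by (simp add: subballean_def bij_betw_def im) (simp add: j_def exp_map_def inj_on_def)
  \<comment> \<open>Effective properness from the embedding, combined with bijectivity, supplies the
    coarse inverse.\<close>
  ultimately have 1: "asymorphism ?P (subballean ?H \<U>) j"
    unfolding asymorphism_def coarse_embedding_def by (blast intro: coarse_map_inv_into)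

  have "coarse_embedding ?P (cube_ballean X \<I>) j"
    using UX by (intro emb ballean_cube assms(1)) (auto simp: cube_ballean_def)
  moreover have "ball_set (cube_ballean X \<I>) \<U> {x} = Pow X"
    using near by (auto simp: ball_set_def) (auto simp: cube_ballean_def)
  ultimately have 2: "coarse_equivalence ?P (cube_ballean X \<I>) j"
    using xI UX unfolding coarse_equivalence_def large_def sP im
    by (auto simp: cube_ballean_def)

  have "ballean ?E"
    using ballean_hyper_iary_sub[OF assms(1), of "Pow X - {{}}"]
    by (simp add: nonempty_hyperballean_def)
  moreover have rE: "radii ?E = \<I>"
    by (simp add: nonempty_hyperballean_def subballean_def hyperballean_def)
  ultimately have "coarse_embedding ?P ?E j"
    using UX ne by (intro emb) (auto simp: sE bE)
  \<comment> \<open>The centres \<open>insert x Y\<close> and the radius \<open>{x}\<close> used for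
    the cube serve again, because a nonempty \<open>Y\<close> survives the restriction.\<close>
  moreover have "ball_set ?E \<U> {x} = Pow X - {{}}"
    using near by (auto simp: ball_set_def bE ne)
  ultimately have 3: "coarse_equivalence ?P ?E j"
    using xI UX unfolding coarse_equivalence_def large_def sP im rE sE by blast
  from 1 2 3 show ?thesis
    by (simp add: Let_def \<U>_def j_def)
qed

end
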